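(* Let $(Q,\cdot,\backslash,/)$ be a left division right cancelation groupoid which satisfies the cyclic associative law $x\cdot(y\cdot z)=(z\cdot x)\cdot y$ for all $x,y,z\in Q$. Then $(Q,\cdot)$ is a commutative group, and it satisfies each of the following identities for all $x,y,z\in Q$: $x\cdot(y\cdot z)=(x\cdot y)\cdot z$; $x\cdot(y\cdot z)=z\cdot(y\cdot x)$; $x\cdot(y\cdot z)=y\cdot(x\cdot z)$; $x\cdot(y\cdot z)=(z\cdot x)\cdot y$.
   Context: A groupoid $(Q,\cdot)$ is a non-empty set $Q$ with a binary operation $\cdot$. For $a\in Q$ let $L_a,R_a:Q\to Q$, $L_a x=a\cdot x$, $R_a x=x\cdot a$. The groupoid is a left division groupoid if $L_a$ is surjective for every $a\in Q$, and a right cancelation groupoid if $R_a$ is injective for every $a\in Q$. Writing a left division right cancelation groupoid as $(Q,\cdot,\backslash,/)$ means that $\backslash$ and $/$ are binary operations on $Q$ satisfying $x\cdot(x\backslash y)=y$ and $(y\cdot x)/x=y$ for all $x,y\in Q$. *)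

theory Defs
  imports "HOL-Algebra.Group"
begin

locale groupoid =
  fixes Q :: "'a set" and mul :: "'a \<Rightarrow> 'a \<Rightarrow> 'a" (infixl "\<cdot>" 70)
  assumes nonempty: "Q \<noteq> {}"
    and mul_closed: "\<lbrakk>x \<in> Q; y \<in> Q\<rbrakk> \<Longrightarrow> x \<cdot> y \<in> Q"

locale left_division_groupoid = groupoid +
  assumes left_translation_surj: "a \<in> Q \<Longrightarrow> (\<lambda>x. a \<cdot> x) ` Q = Q"

locale right_cancelation_groupoid = groupoid +
  assumes right_translation_inj: "a \<in> Q \<Longrightarrow> inj_on (\<lambda>x. x \<cdot> a) Q"

text \<open>The argument order follows the infix notation: \<open>ldiv x y\<close> is \<open>x \ y\<close>,
  and \<open>rdiv y x\<close> is \<open>y / x\<close>.\<close>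

locale left_division_right_cancelation_groupoid =
  left_division_groupoid Q mul + right_cancelation_groupoid Q mul
  for Q :: "'a set" and mul :: "'a \<Rightarrow> 'a \<Rightarrow> 'a" (infixl "\<cdot>" 70) +
  fixes ldiv rdiv :: "'a \<Rightarrow> 'a \<Rightarrow> 'a"
  assumes ldiv_closed: "\<lbrakk>x \<in> Q; y \<in> Q\<rbrakk> \<Longrightarrow> ldiv x y \<in> Q"
    and rdiv_closed: "\<lbrakk>x \<in> Q; y \<in> Q\<rbrakk> \<Longrightarrow> rdiv x y \<in> Q"
    and mul_ldiv: "\<lbrakk>x \<in> Q; y \<in> Q\<rbrakk> \<Longrightarrow> x \<cdot> ldiv x y = y"
    and mul_rdiv: "\<lbrakk>x \<in> Q; y \<in> Q\<rbrakk> \<Longrightarrow> rdiv (y \<cdot> x) x = y"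

end

theory Submission
  imports Defs
begin

text \<open>Choose \<open>e\<close> with \<open>a \<cdot> e = a\<close> for one element \<open>a\<close>. The cyclic law gives
  \<open>x \<cdot> a = x \<cdot> (a \<cdot> e) = (e \<cdot> x) \<cdot> a\<close>, and cancelling \<open>a\<close> makes \<open>e\<close> a left identity. Substituting
  \<open>e\<close> into the cyclic law then shows that \<open>e\<close> is also a right identity and that the operation
  commutes, after which the cyclic law is associativity.\<close>


theorem theorem5:
  fixes Q :: "'a set"
    and mul :: "'a \<Rightarrow> 'a \<Rightarrow> 'a" (infixl "\<cdot>" 70)
    and ldiv rdiv :: "'a \<Rightarrow> 'a \<Rightarrow> 'a"
  assumes "left_division_right_cancelation_groupoid Q mul ldiv rdiv"
    and "\<forall>x\<in>Q. \<forall>y\<in>Q. \<forall>z\<in>Q. x \<cdot> (y \<cdot> z) = (z \<cdot> x) \<cdot> y"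
  shows "(\<exists>e. comm_group \<lparr>carrier = Q, mult = mul, one = e\<rparr>)
    \<and> (\<forall>x\<in>Q. \<forall>y\<in>Q. \<forall>z\<in>Q. x \<cdot> (y \<cdot> z) = (x \<cdot> y) \<cdot> z)
    \<and> (\<forall>x\<in>Q. \<forall>y\<in>Q. \<forall>z\<in>Q. x \<cdot> (y \<cdot> z) = z \<cdot> (y \<cdot> x))
    \<and> (\<forall>x\<in>Q. \<forall>y\<in>Q. \<forall>z\<in>Q. x \<cdot> (y \<cdot> z) = y \<cdot> (x \<cdot> z))
    \<and> (\<forall>x\<in>Q. \<forall>y\<in>Q. \<forall>z\<in>Q. x \<cdot> (y \<cdot> z) = (z \<cdot> x) \<cdot> y)"
proof -
  interpret left_division_right_cancelation_groupoid Q mul ldiv rdiv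
    by (fact assms(1))
  have cyclic: "x \<cdot> (y \<cdot> z) = (z \<cdot> x) \<cdot> y" if "x \<in> Q" "y \<in> Q" "z \<in> Q" for x y z
    using assms(2) that by blast
  have cancel: "x = y" if "x \<cdot> a = y \<cdot> a" "x \<in> Q" "y \<in> Q" "a \<in> Q" for x y a
    using that right_translation_inj[of a] by (auto dest: inj_onD)
  obtain a where a: "a \<in> Q"
    using nonempty by blast
  define e where "e = ldiv a a"
  have e: "e \<in> Q" and ae: "a \<cdot> e = a"
    using a by (simp_all add: e_def ldiv_closed mul_ldiv)
  have left_id: "e \<cdot> x = x" if x: "x \<in> Q" for x
    using cyclic[OF x a e] ae cancel[of "e \<cdot> x" a x] a e x by (simp add: mul_closed)
  \<comment> \<open>Placing \<open>e\<close> in the middle of the cyclic law lets the left identity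
    absorb it. The result is commutativity up to a right factor \<open>e\<close>, which
    \<open>right_id\<close> then removes.\<close>
  have swap: "x \<cdot> z = (z \<cdot> x) \<cdot> e" if "x \<in> Q" "z \<in> Q" for x z
    using cyclic[OF that(1) e that(2)] left_id[OF that(2)] by simp
  have right_id: "y \<cdot> e = y" if y: "y \<in> Q" for y
  proof -
    \<comment> \<open>The chain shows that three right multiplications of \<open>y\<close> by
      \<open>e\<close> give the same as two, so cancelling \<open>e\<close> twice leaves
      \<open>y \<cdot> e = y\<close>.\<close>
    have "((y \<cdot> e) \<cdot> e) \<cdot> e = e \<cdot> (y \<cdot> e)"
      using swap[of e "y \<cdot> e"] y e by (simp add: mul_closed)
    also have "\<dots> = e \<cdot> y"
      using cyclic[OF e y e] left_id[OF e] by simp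
    also have "\<dots> = (y \<cdot> e) \<cdot> e"
      by (rule swap[OF e y])
    finally show ?thesis
      using cancel[of "(y \<cdot> e) \<cdot> e" e "y \<cdot> e"] cancel[of "y \<cdot> e" e y] y e
      by (simp add: mul_closed)
  qed
  have comm: "x \<cdot> y = y \<cdot> x" if "x \<in> Q" "y \<in> Q" for x y
    using swap[OF that] right_id[of "y \<cdot> x"] that by (simp add: mul_closed)
  have assoc: "x \<cdot> (y \<cdot> z) = (x \<cdot> y) \<cdot> z" if "x \<in> Q" "y \<in> Q" "z \<in> Q" for x y z
    \<comment> \<open>The key instance is
      \<open>z \<cdot> (x \<cdot> y) = (y \<cdot> z) \<cdot> x\<close>; commuting the outer product
      on each side turns it into associativity.\<close>
    using cyclic[of z x y] comm[of z "x \<cdot> y"] cyclic[of y z x] comm[of "y \<cdot> z" x]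
      comm[of "z \<cdot> x" y] cyclic[of x y z] that by (simp add: mul_closed)
  \<comment> \<open>Left division yields a right inverse; \<open>comm\<close> turns it into the left
    inverse that \<open>comm_groupI\<close> asks for.\<close>
  have inverse: "ldiv x e \<in> Q \<and> ldiv x e \<cdot> x = e" if "x \<in> Q" for x
    using that e comm[of "ldiv x e" x] by (simp add: ldiv_closed mul_ldiv)
  have "comm_group \<lparr>carrier = Q, mult = mul, one = e\<rparr>"
  proof (rule comm_groupI)
    fix x assume "x \<in> carrier \<lparr>carrier = Q, mult = mul, one = e\<rparr>"
    then show "\<exists>y\<in>carrier \<lparr>carrier = Q, mult = mul, one = e\<rparr>.
        y \<otimes>\<^bsub>\<lparr>carrier = Q, mult = mul, one = e\<rparr>\<^esub> x = \<one>\<^bsub>\<lparr>carrier = Q, mult = mul, one = e\<rparr>\<^esub>"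
      using inverse[of x] by auto
  qed (auto simp: mul_closed e left_id assoc intro: comm)
  moreover have "x \<cdot> (y \<cdot> z) = z \<cdot> (y \<cdot> x)" if "x \<in> Q" "y \<in> Q" "z \<in> Q" for x y z
    using assoc[of x y z] comm[of "x \<cdot> y" z] comm[of x y] that by (simp add: mul_closed)
  moreover have "x \<cdot> (y \<cdot> z) = y \<cdot> (x \<cdot> z)" if "x \<in> Q" "y \<in> Q" "z \<in> Q" for x y z
    using assoc[of x y z] assoc[of y x z] comm[of x y] that by simp
  ultimately show ?thesis
    using assoc cyclic by blast
qed

end
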